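(* Let $\mathcal A,\mathcal E$ be finite sets, $P_{A,E}$ a probability distribution on $\mathcal A\times\mathcal E$, $\mathsf M$ a positive integer and $\varepsilon>0$. Then $$\Delta_{I,2}(\mathsf M,\varepsilon|P_{A,E})\le\eta\bigl(\mathsf M^se^{-sH_{1+s}^{\downarrow}(A|E|P_{A,E})},\ \varepsilon+\log\mathsf M\bigr)$$ holds for every $s\in(0,1]$.
   Context: Logarithms are natural. $\eta(x,y)=xy-x\log x$. A sub-distribution is a nonnegative function with total sum $\le1$; $P_E(e)=\sum_aP_{A,E}(a,e)$; $\|\cdot\|_1$ is the sum of absolute values. For $s\neq0$, $H_{1+s}^\downarrow(A|E|P_{A,E})=-\frac1s\log\sum_{a,e}P_{A,E}(a,e)^{1+s}P_E(e)^{-s}$ (sum over $e$ with $P_E(e)>0$). $H_2(A|E|P'\|P_E)=-\log\sum_{a,e}P'(a,e)^2P_E(e)^{-1}$. With the minimum understood as an infimum, $$\Delta_{I,2}(\mathsf M,\varepsilon|P_{A,E})=\min_{P'_{A,E}:\,P'_E\le P_E}\Bigl[\eta(\|P_{A,E}-P'_{A,E}\|_1,\log\mathsf M)+\varepsilon\mathsf M e^{-H_2(A|E|P'_{A,E}\|P_E)}\Bigr],$$ where $P'_{A,E}$ ranges over sub-distributions on $\mathcal A\times\mathcal E$ with $P'_E(e):=\sum_aP'_{A,E}(a,e)\le P_E(e)$ for all $e$. *)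

theory Defs
  imports "HOL-Analysis.Analysis"
begin

text \<open>
  A function on the product of two finite sets \<open>A\<close> and \<open>E\<close> is represented by a total
  function \<open>'a \<times> 'e \<Rightarrow> real\<close>, of which only the values on \<open>A \<times> E\<close> are ever inspected.
\<close>

definition prob_dist :: "'x set \<Rightarrow> ('x \<Rightarrow> real) \<Rightarrow> bool" where
  "prob_dist X P \<longleftrightarrow> (\<forall>x\<in>X. 0 \<le> P x) \<and> (\<Sum>x\<in>X. P x) = 1"

definition sub_dist :: "'x set \<Rightarrow> ('x \<Rightarrow> real) \<Rightarrow> bool" where
  "sub_dist X P \<longleftrightarrow> (\<forall>x\<in>X. 0 \<le> P x) \<and> (\<Sum>x\<in>X. P x) \<le> 1"

definition marginal :: "'a set \<Rightarrow> ('a \<times> 'e \<Rightarrow> real) \<Rightarrow> 'e \<Rightarrow> real" where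
  "marginal A P e = (\<Sum>a\<in>A. P (a, e))"

definition norm1 :: "'x set \<Rightarrow> ('x \<Rightarrow> real) \<Rightarrow> real" where
  "norm1 X f = (\<Sum>x\<in>X. \<bar>f x\<bar>)"

text \<open>Since \<open>ln 0 = 0\<close>, the usual convention \<open>0 log 0 = 0\<close> is built in.\<close>

definition eta :: "real \<Rightarrow> real \<Rightarrow> real" where
  "eta x y = x * y - x * ln x"

text \<open>\<open>H_down A E s P\<close> is the conditional Renyi entropy of order \<open>1 + s\<close>, for \<open>s \<noteq> 0\<close>.\<close>

definition H_down :: "'a set \<Rightarrow> 'e set \<Rightarrow> real \<Rightarrow> ('a \<times> 'e \<Rightarrow> real) \<Rightarrow> real" where
  "H_down A E s P =
     - (1 / s) * ln (\<Sum>a\<in>A. \<Sum>e\<in>{e\<in>E. 0 < marginal A P e}.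
                       P (a, e) powr (1 + s) * marginal A P e powr (- s))"

text \<open>
  The collision entropy relative to \<open>Q\<close> is extended-real valued, because it is \<open>+\<infinity>\<close> when the
  sum vanishes (for instance for \<open>P' = 0\<close>), whereas the real \<open>ln 0\<close> would be \<open>0\<close>.
  It is only meant for \<open>P'\<close> whose marginal is dominated by \<open>Q\<close>; then \<open>Q e = 0\<close> forces
  \<open>P' (a, e) = 0\<close>, and \<open>inverse 0 = 0\<close> amounts to the convention \<open>0 / 0 = 0\<close>.
\<close>

definition H2 :: "'a set \<Rightarrow> 'e set \<Rightarrow> ('a \<times> 'e \<Rightarrow> real) \<Rightarrow> ('e \<Rightarrow> real) \<Rightarrow> ereal" where
  "H2 A E P' Q =
     (let S = (\<Sum>a\<in>A. \<Sum>e\<in>E. (P' (a, e))\<^sup>2 * inverse (Q e))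
      in if S = 0 then \<infinity> else ereal (- ln S))"

text \<open>The value \<open>exp (- h)\<close> for \<open>h > -\<infinity>\<close>, with \<open>exp (-\<infinity>) = 0\<close>.\<close>

definition exp_neg :: "ereal \<Rightarrow> real" where
  "exp_neg h = (if h = \<infinity> then 0 else exp (- real_of_ereal h))"

definition feasible :: "'a set \<Rightarrow> 'e set \<Rightarrow> ('a \<times> 'e \<Rightarrow> real) \<Rightarrow> ('a \<times> 'e \<Rightarrow> real) set" where
  "feasible A E P =
     {P'. sub_dist (A \<times> E) P' \<and> (\<forall>e\<in>E. marginal A P' e \<le> marginal A P e)}"

definition Delta_objective ::
    "'a set \<Rightarrow> 'e set \<Rightarrow> nat \<Rightarrow> real \<Rightarrow> ('a \<times> 'e \<Rightarrow> real) \<Rightarrow> ('a \<times> 'e \<Rightarrow> real) \<Rightarrow> real" where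
  "Delta_objective A E M \<epsilon> P P' =
     eta (norm1 (A \<times> E) (\<lambda>x. P x - P' x)) (ln (real M))
     + \<epsilon> * real M * exp_neg (H2 A E P' (marginal A P))"

text \<open>
  The infimum is taken in the reals; the two lemmas below show that the set of objective values
  is nonempty and bounded below, so that it is the genuine infimum.
\<close>

definition Delta_I2 ::
    "'a set \<Rightarrow> 'e set \<Rightarrow> nat \<Rightarrow> real \<Rightarrow> ('a \<times> 'e \<Rightarrow> real) \<Rightarrow> real" where
  "Delta_I2 A E M \<epsilon> P = (INF P'\<in>feasible A E P. Delta_objective A E M \<epsilon> P P')"

lemma self_feasible: "prob_dist (A \<times> E) P \<Longrightarrow> P \<in> feasible A E P"
  by (simp add: feasible_def prob_dist_def sub_dist_def)

lemma Delta_objective_bdd_below: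
  assumes P: "prob_dist (A \<times> E) P" and M: "1 \<le> M" and eps: "0 < \<epsilon>"
  shows "bdd_below (Delta_objective A E M \<epsilon> P ` feasible A E P)"
proof (rule bdd_belowI2[where m = "-2"])
  fix P' assume "P' \<in> feasible A E P"
  then have P': "sub_dist (A \<times> E) P'" by (simp add: feasible_def)
  define t where "t = norm1 (A \<times> E) (\<lambda>x. P x - P' x)"
  have t0: "0 \<le> t" by (simp add: t_def norm1_def sum_nonneg)
  have "t \<le> (\<Sum>x\<in>A \<times> E. P x + P' x)"
    unfolding t_def norm1_def using P P'
    by (intro sum_mono) (fastforce simp: prob_dist_def sub_dist_def abs_le_iff)
  also have "\<dots> \<le> 2" using P P' by (simp add: prob_dist_def sub_dist_def sum.distrib)
  finally have t2: "t \<le> 2" .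
  have "t * ln t \<le> 2"
  proof (cases "t = 0")
    case False
    then have "ln t \<le> 1" using t0 t2 ln_le_minus_one[of t] by simp
    then have "t * ln t \<le> t * 1" using t0 by (rule mult_left_mono)
    then show ?thesis using t2 by simp
  qed simp
  moreover have "0 \<le> t * ln (real M)" using t0 M by simp
  moreover have "0 \<le> \<epsilon> * real M * exp_neg (H2 A E P' (marginal A P))"
    using eps by (simp add: exp_neg_def)
  ultimately show "- 2 \<le> Delta_objective A E M \<epsilon> P P'"
    unfolding Delta_objective_def eta_def t_def[symmetric] by linarith
qed

end

theory Submission
  imports Defs
begin

text \<open>
  With \<open>X = M P(a,e) / P_E(e)\<close> and \<open>f x = eta x (ln M)\<close>, the right-hand side is
  \<open>f T + \<epsilon> T\<close>, where \<open>T\<close> is the mean of \<open>X powr s\<close> under \<open>P\<close>. The truncation of \<open>P\<close> to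
  \<open>X \<le> 1\<close> has objective value \<open>f \<delta> + \<epsilon> B\<close> with \<open>\<delta> \<le> T\<close> and \<open>B \<le> T\<close>, but \<open>f\<close> decreases
  beyond \<open>M / e\<close>, so this alone is not enough. The other candidate is \<open>P\<close> itself, with value
  \<open>\<epsilon>\<close> times the mean of \<open>X\<close>, that is \<open>\<epsilon> (E + B)\<close> with \<open>E\<close> the contribution of \<open>X > 1\<close>.
  If both candidates exceeded the bound, eliminating \<open>\<epsilon>\<close> would give
  \<open>E f(T) < (E + B - T) f(\<delta>)\<close>, which concavity of \<open>f\<close> and of \<open>x powr s\<close> excludes.
\<close>

section \<open>Concavity of \<open>x powr s\<close>\<close>

text \<open>Weighted AM-GM for \<open>x\<close> and 1 with weights \<open>s\<close> and
  \<open>1 - s\<close>; the right-hand side is the tangent at 1.\<close>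

lemma powr_le_affine:
  fixes x s :: real
  assumes "0 \<le> s" "s \<le> 1" "0 < x"
  shows "x powr s \<le> 1 - s + s * x"
  using Youngs_inequality_0[of s "1 - s" x 1] assms by simp

text \<open>Concavity between 1 and \<open>b\<close>, with denominators cleared so that
  \<open>b = 1\<close> is allowed and averaging over \<open>x\<close> is immediate.\<close>

lemma powr_ge_chord:
  fixes x b s :: real
  assumes "0 \<le> s" "s \<le> 1" "1 \<le> x" "x \<le> b"
  shows "(x - 1) * (b powr s - 1) \<le> (x powr s - 1) * (b - 1)"
proof -
  \<comment> \<open>Rescaled by \<open>x powr s\<close>, the affine bound at \<open>1 / x\<close>
    and \<open>b / x\<close> is the tangent at \<open>x\<close>, evaluated at 1 and
    \<open>b\<close>. The weights are those that express \<open>x\<close> through 1 and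
    \<open>b\<close>, so the slope terms cancel.\<close>
  have "(b - x) * (1 / x) powr s \<le> (b - x) * (1 - s + s * (1 / x))"
    using assms by (intro mult_left_mono powr_le_affine) auto
  moreover have "(x - 1) * (b / x) powr s \<le> (x - 1) * (1 - s + s * (b / x))"
    using assms by (intro mult_left_mono powr_le_affine) auto
  moreover have "(b - x) * (1 - s + s * (1 / x)) + (x - 1) * (1 - s + s * (b / x)) = b - 1"
    using assms by (simp add: field_simps)
  ultimately have "(b - x) * (1 / x) powr s + (x - 1) * (b / x) powr s \<le> b - 1"
    by linarith
  then have "((b - x) * (1 / x) powr s + (x - 1) * (b / x) powr s) * x powr s \<le> (b - 1) * x powr s"
    by (rule mult_right_mono) simp
  moreover have "(1 / x) powr s * x powr s = 1" "(b / x) powr s * x powr s = b powr s"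
    using assms by (simp_all flip: powr_mult)
  ultimately have "(b - x) * 1 + (x - 1) * b powr s \<le> (b - 1) * x powr s"
    by (simp add: algebra_simps)
  then show ?thesis
    by (simp add: algebra_simps)
qed

section \<open>Concavity and lower bounds of \<open>eta\<close>\<close>

text \<open>The right-hand side is the tangent at \<open>z\<close>; for positive \<open>x\<close>
  the bound is \<open>ln (z / x) \<le> z / x - 1\<close> multiplied by \<open>x\<close>.\<close>

lemma eta_le_tangent:
  assumes "0 \<le> x" "0 < z"
  shows "eta x y \<le> x * y - x * ln z + z - x"
proof (cases "x = 0")
  case False
  then have x: "0 < x" using assms by simp
  have "x * ln (z / x) \<le> x * (z / x - 1)"
    using x assms ln_le_minus_one[of "z / x"] by (intro mult_left_mono) auto
  then show ?thesis
    using x assms by (simp add: eta_def ln_div algebra_simps)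
qed (use assms in \<open>simp add: eta_def\<close>)

text \<open>Averaging the tangent bound at the mean \<open>z\<close> needs no derivatives and so
  includes the endpoint 0.\<close>

lemma concave_on_eta: "concave_on {0..} (\<lambda>x. eta x y)"
  unfolding concave_on_iff
proof (intro conjI ballI allI impI)
  fix a b u v :: real
  assume "a \<in> {0..}" "b \<in> {0..}" and uv: "0 \<le> u" "0 \<le> v" "u + v = 1"
  then have ab: "0 \<le> a" "0 \<le> b" by auto
  define z where "z = u * a + v * b"
  have z0: "0 \<le> z" using ab uv by (simp add: z_def)
  have "u * eta a y + v * eta b y \<le> eta z y"
  proof (cases "z = 0")
    \<comment> \<open>There is no tangent at 0, but here each summand has zero weight or sits at the
      point 0.\<close>
    case True
    then have "u * a = 0" "v * b = 0"
      using ab uv by (simp_all add: z_def add_nonneg_eq_0_iff)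
    then show ?thesis using True by (auto simp: eta_def)
  next
    case False
    then have z: "0 < z" using z0 by simp
    have "u * eta a y + v * eta b y
        \<le> u * (a * y - a * ln z + z - a) + v * (b * y - b * ln z + z - b)"
      using ab uv z by (intro add_mono mult_left_mono eta_le_tangent)
    also have "\<dots> = z * y - z * ln z + (u + v) * z - z"
      by (simp add: z_def algebra_simps)
    also have "\<dots> = eta z y" using uv by (simp add: eta_def)
    finally show ?thesis .
  qed
  then show "u * eta a y + v * eta b y \<le> eta (u *\<^sub>R a + v *\<^sub>R b) y"
    by (simp add: z_def)
qed simp

lemma eta_concaveD:
  assumes "0 \<le> a" "0 \<le> b" "0 \<le> u" "u \<le> 1"
  shows "(1 - u) * eta a y + u * eta b y \<le> eta ((1 - u) * a + u * b) y"
  using concave_onD[OF concave_on_eta, of u a b y] assms by simp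

lemma eta_nonneg:
  assumes "0 \<le> x" "x \<le> b"
  shows "0 \<le> eta x (ln b)"
proof (cases "x = 0")
  case False
  then have "x * ln x \<le> x * ln b" using assms by (intro mult_left_mono) auto
  then show ?thesis by (simp add: eta_def)
qed (simp add: eta_def)

text \<open>The right-hand side is \<open>(1 - s) * b powr s * ln b\<close>, so the affine bound at
  \<open>1 / b\<close>, multiplied by \<open>b powr s\<close>, suffices.\<close>

lemma eta_powr_ge:
  fixes b s :: real
  assumes "1 \<le> b" "0 \<le> s" "s \<le> 1"
  shows "(1 - b powr (s - 1)) * ln b \<le> eta (b powr s) (ln b)"
proof -
  have "(1 / b) powr s \<le> 1 - s + s * (1 / b)"
    using assms by (intro powr_le_affine) auto
  also have "\<dots> \<le> 1 - s + 1 / b"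
    using assms by (simp add: divide_right_mono)
  finally have "(1 / b) powr s * b powr s \<le> (1 - s + 1 / b) * b powr s"
    by (rule mult_right_mono) simp
  moreover have "(1 / b) powr s * b powr s = 1"
    using assms by (simp flip: powr_mult)
  moreover have "(1 / b) * b powr s = b powr (s - 1)"
    using assms by (simp add: powr_diff)
  ultimately have "1 - b powr (s - 1) \<le> (1 - s) * b powr s"
    by (simp add: algebra_simps)
  then have "(1 - b powr (s - 1)) * ln b \<le> (1 - s) * b powr s * ln b"
    using assms by (intro mult_right_mono) auto
  also have "\<dots> = eta (b powr s) (ln b)"
    using assms by (simp add: eta_def ln_powr algebra_simps)
  finally show ?thesis .
qed

section \<open>Bounds on \<open>eta\<close> at mixed moments\<close>

text \<open>
  Below, \<open>m\<close> and \<open>\<tau>\<close> are the means of \<open>Y\<close> and of \<open>Y powr s\<close> for a random variable \<open>Y\<close> with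
  values in \<open>{1..b}\<close>; averaging the chord inequality for \<open>powr\<close> gives the hypothesis \<open>chord\<close>.
\<close>

lemma eta_moment_ge:
  fixes b s m \<tau> :: real
  assumes b: "1 < b" and s: "0 < s" "s \<le> 1" and tau: "1 \<le> \<tau>" "\<tau> \<le> b powr s"
    and m: "1 \<le> m"
    and chord: "(m - 1) * (b powr s - 1) \<le> (\<tau> - 1) * (b - 1)"
  shows "(m - \<tau>) * ln b \<le> m * eta \<tau> (ln b)"
proof -
  have bs: "1 < b powr s" using b s by simp
  \<comment> \<open>\<open>q\<close> is the weight that makes \<open>\<tau>\<close> a mixture of 1
    and \<open>b powr s\<close>.\<close>
  define q where "q = (\<tau> - 1) / (b powr s - 1)"
  define t where "t = b powr (s - 1)"
  have q: "0 \<le> q" "q \<le> 1" using tau bs by (auto simp: q_def)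
  have t: "0 \<le> t" "b powr s = t * b" using b by (auto simp: t_def powr_diff)
  have tau_q: "\<tau> - 1 = q * (b powr s - 1)"
    using bs by (simp add: q_def)
  have tau_eq: "\<tau> = (1 - q) * 1 + q * b powr s"
    using tau_q by (simp add: algebra_simps)
  have L: "0 < ln b" using b by simp
  \<comment> \<open>Among variables with given \<open>\<tau>\<close>, the extreme one takes only the
    values 1 and \<open>b\<close>, the latter with probability \<open>q\<close>.\<close>
  from chord tau_q have "(m - 1) * (b powr s - 1) \<le> (q * (b - 1)) * (b powr s - 1)"
    by (simp add: mult_ac)
  then have m_le: "m \<le> 1 + q * (b - 1)"
    using bs by (simp add: mult_le_cancel_right)
  have "(1 - q) * ln b + q * ((1 - t) * ln b)
      \<le> (1 - q) * eta 1 (ln b) + q * eta (b powr s) (ln b)"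
    using q b s eta_powr_ge[of b s] unfolding t_def
    by (intro add_mono mult_left_mono) (auto simp: eta_def)
  also have "\<dots> \<le> eta \<tau> (ln b)"
    unfolding tau_eq using q by (intro eta_concaveD) auto
  finally have eta_ge: "(1 - q * t) * ln b \<le> eta \<tau> (ln b)"
    by (simp add: algebra_simps)
  have "m * (q * t) \<le> (1 + q * (b - 1)) * (q * t)"
    using m_le q t by (intro mult_right_mono) auto
  also have "\<dots> \<le> \<tau>"
  proof -
    \<comment> \<open>This product is exactly the difference of the two sides.\<close>
    have "0 \<le> (1 - q) * (1 + q * t * (b - 1))"
      using q t b by (intro mult_nonneg_nonneg add_nonneg_nonneg) auto
    then show ?thesis unfolding tau_eq t(2) by (simp add: algebra_simps)
  qed
  finally have "(m - \<tau>) * ln b \<le> m * (1 - q * t) * ln b"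
    using L by (intro mult_right_mono) (auto simp: algebra_simps)
  also have "\<dots> \<le> m * eta \<tau> (ln b)"
    using eta_ge m by (simp add: mult.assoc mult_left_mono)
  finally show ?thesis .
qed

text \<open>Here \<open>\<delta>\<close> is the mass of the event \<open>X > 1\<close>,
  \<open>m\<close> and \<open>\<tau>\<close> are the conditional means of \<open>X\<close> and
  \<open>X powr s\<close> on it, and \<open>T0\<close> is the contribution of the complement, so
  \<open>\<delta> * \<tau> + T0\<close> is the full moment.\<close>

lemma eta_mixture_ge:
  fixes b s m \<tau> \<delta> T0 :: real
  assumes b: "1 < b" and s: "0 < s" "s \<le> 1" and tau: "1 \<le> \<tau>" "\<tau> \<le> b powr s"
    and m: "1 \<le> m" "m \<le> b"
    and chord: "(m - 1) * (b powr s - 1) \<le> (\<tau> - 1) * (b - 1)"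
    and delta: "0 < \<delta>" "\<delta> \<le> 1" and T0: "0 \<le> T0" "T0 \<le> 1 - \<delta>"
  shows "(m - \<tau>) * eta \<delta> (ln b) \<le> m * eta (\<delta> * \<tau> + T0) (ln b)"
proof (cases "m \<le> \<tau>")
  case True
  \<comment> \<open>The left-hand side is nonpositive, so it is enough that the mixture stays below
    \<open>b\<close>, where \<open>eta\<close> is nonnegative.\<close>
  have "b powr s \<le> b" using b s powr_mono[of s 1 b] by simp
  then have "\<delta> * \<tau> \<le> \<delta> * b" using tau delta by (intro mult_left_mono) auto
  moreover have "T0 \<le> (1 - \<delta>) * b"
    using T0 delta b mult_left_mono[of 1 b "1 - \<delta>"] by simp
  ultimately have "\<delta> * \<tau> + T0 \<le> b" by (simp add: algebra_simps)
  then have "0 \<le> m * eta (\<delta> * \<tau> + T0) (ln b)"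
    using m delta tau T0 by (intro mult_nonneg_nonneg eta_nonneg) auto
  moreover have "0 \<le> eta \<delta> (ln b)"
    using delta b by (intro eta_nonneg) auto
  then have "(m - \<tau>) * eta \<delta> (ln b) \<le> 0"
    using True by (intro mult_nonpos_nonneg) auto
  ultimately show ?thesis by linarith
next
  case False
  have key: "(m - \<tau>) * ln b \<le> m * eta \<tau> (ln b)"
    using assms by (intro eta_moment_ge)
  have eta_delta: "eta \<delta> (ln b) = \<delta> * ln b + \<delta> * ln (1 / \<delta>)"
    using delta by (simp add: eta_def ln_div)
  have r: "0 \<le> ln (1 / \<delta>)" using delta by simp
  \<comment> \<open>By concavity only the two extreme values of \<open>T0\<close> matter.\<close>
  have left: "(m - \<tau>) * eta \<delta> (ln b) \<le> m * eta (\<delta> * \<tau>) (ln b)"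
  proof -
    \<comment> \<open>Scaling by \<open>\<delta>\<close> turns \<open>eta \<tau>\<close> into
      \<open>\<delta>\<close> times \<open>eta \<tau>\<close> plus
      \<open>\<tau> * ln (1 / \<delta>)\<close>; the two parts are compared separately.\<close>
    have "m * 1 \<le> m * \<tau>" using tau m by (intro mult_left_mono) auto
    then have "(m - \<tau>) * ln (1 / \<delta>) \<le> m * \<tau> * ln (1 / \<delta>)"
      using r tau by (intro mult_right_mono) linarith+
    with key have "(m - \<tau>) * ln b + (m - \<tau>) * ln (1 / \<delta>)
        \<le> m * eta \<tau> (ln b) + m * \<tau> * ln (1 / \<delta>)"
      by linarith
    from mult_left_mono[OF this, of \<delta>] show ?thesis
      using delta tau unfolding eta_delta
      by (simp add: eta_def ln_mult ln_div algebra_simps)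
  qed
  have right: "(m - \<tau>) * eta \<delta> (ln b) \<le> m * eta (\<delta> * \<tau> + (1 - \<delta>)) (ln b)"
  proof -
    \<comment> \<open>The argument is now a mixture of \<open>\<tau>\<close> and 1. The part at
      \<open>\<tau>\<close> is handled by \<open>key\<close>, the part at 1 by
      \<open>m - \<tau> \<le> m * ln b\<close>, which uses \<open>m \<le> b\<close>.\<close>
    have "ln (1 / b) \<le> 1 / b - 1" using b by (intro ln_le_minus_one) auto
    then have L: "1 - 1 / b \<le> ln b" using b by (simp add: ln_div)
    have "m * (1 / b) \<le> 1" using m b by simp
    then have "m - \<tau> \<le> m * (1 - 1 / b)" using tau by (simp add: algebra_simps)
    also have "\<dots> \<le> m * ln b" using L m by (intro mult_left_mono) auto
    finally have mt: "m - \<tau> \<le> m * ln b" .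
    have "\<delta> * ln (1 / \<delta>) \<le> \<delta> * (1 / \<delta> - 1)"
      using delta by (intro mult_left_mono ln_le_minus_one) auto
    then have "\<delta> * ln (1 / \<delta>) \<le> 1 - \<delta>" using delta by (simp add: algebra_simps)
    then have "(m - \<tau>) * eta \<delta> (ln b) \<le> (m - \<tau>) * (\<delta> * ln b + (1 - \<delta>))"
      unfolding eta_delta using False by (intro mult_left_mono) auto
    also have "\<dots> = \<delta> * ((m - \<tau>) * ln b) + (1 - \<delta>) * (m - \<tau>)"
      by (simp add: algebra_simps)
    also have "\<dots> \<le> \<delta> * (m * eta \<tau> (ln b)) + (1 - \<delta>) * (m * ln b)"
      using key mt delta by (intro add_mono mult_left_mono) auto
    also have "\<dots> = m * ((1 - \<delta>) * eta 1 (ln b) + \<delta> * eta \<tau> (ln b))"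
      by (simp add: eta_def algebra_simps)
    also have "\<dots> \<le> m * eta ((1 - \<delta>) * 1 + \<delta> * \<tau>) (ln b)"
      using delta tau m by (intro mult_left_mono eta_concaveD) auto
    finally show ?thesis by (simp add: algebra_simps)
  qed
  show ?thesis
  proof (cases "\<delta> = 1")
    case True
    then show ?thesis using left T0 by simp
  next
    case False
    define u where "u = T0 / (1 - \<delta>)"
    have u: "0 \<le> u" "u \<le> 1" "T0 = u * (1 - \<delta>)"
      using T0 delta False by (auto simp: u_def)
    have "(m - \<tau>) * eta \<delta> (ln b)
        = (1 - u) * ((m - \<tau>) * eta \<delta> (ln b)) + u * ((m - \<tau>) * eta \<delta> (ln b))"
      by (simp add: algebra_simps)
    also have "\<dots> \<le> (1 - u) * (m * eta (\<delta> * \<tau>) (ln b))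
        + u * (m * eta (\<delta> * \<tau> + (1 - \<delta>)) (ln b))"
      using left right u by (intro add_mono mult_left_mono) auto
    also have "\<dots> = m * ((1 - u) * eta (\<delta> * \<tau>) (ln b) + u * eta (\<delta> * \<tau> + (1 - \<delta>)) (ln b))"
      by (simp add: algebra_simps)
    also have "\<dots> \<le> m * eta ((1 - u) * (\<delta> * \<tau>) + u * (\<delta> * \<tau> + (1 - \<delta>))) (ln b)"
      using u delta tau m by (intro mult_left_mono eta_concaveD) auto
    also have "(1 - u) * (\<delta> * \<tau>) + u * (\<delta> * \<tau> + (1 - \<delta>)) = \<delta> * \<tau> + T0"
      unfolding u(3) by (simp add: algebra_simps)
    finally show ?thesis .
  qed
qed

section \<open>The choice between the two candidates\<close>

text \<open>The entropies are abstracted to a bounded variable \<open>X\<close> on a finite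
  probability space; the disjuncts stand for the untruncated and the truncated candidate.\<close>

lemma truncation_tradeoff:
  fixes w X :: "'x \<Rightarrow> real" and b s \<epsilon> :: real
  assumes fin: "finite S" and w: "prob_dist S w"
    and X: "\<And>x. x \<in> S \<Longrightarrow> 0 \<le> X x" "\<And>x. x \<in> S \<Longrightarrow> X x \<le> b"
    and b: "1 \<le> b" and s: "0 < s" "s \<le> 1" and eps: "0 < \<epsilon>"
  defines "T \<equiv> \<Sum>x\<in>S. w x * X x powr s"
  shows "\<epsilon> * (\<Sum>x\<in>S. w x * X x) \<le> eta T (\<epsilon> + ln b) \<or>
    eta (\<Sum>x\<in>{x\<in>S. 1 < X x}. w x) (ln b) + \<epsilon> * (\<Sum>x\<in>{x\<in>S. X x \<le> 1}. w x * X x)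
      \<le> eta T (\<epsilon> + ln b)"
proof -
  define H where "H = {x\<in>S. 1 < X x}"
  define K where "K = {x\<in>S. X x \<le> 1}"
  have split: "(\<Sum>x\<in>S. f x) = (\<Sum>x\<in>H. f x) + (\<Sum>x\<in>K. f x)" for f :: "'x \<Rightarrow> real"
  proof -
    have "S = H \<union> K" "H \<inter> K = {}" by (auto simp: H_def K_def)
    with fin show ?thesis by (metis finite_Un sum.union_disjoint)
  qed
  have w0: "0 \<le> w x" if "x \<in> S" for x using w that by (simp add: prob_dist_def)
  define \<delta> where "\<delta> = (\<Sum>x\<in>H. w x)"
  define E1 where "E1 = (\<Sum>x\<in>H. w x * X x)"
  define T1 where "T1 = (\<Sum>x\<in>H. w x * X x powr s)"
  define B1 where "B1 = (\<Sum>x\<in>K. w x * X x)"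
  define T0 where "T0 = (\<Sum>x\<in>K. w x * X x powr s)"
  have T_eq: "T = T1 + T0" unfolding T_def T1_def T0_def by (rule split)
  have EX_eq: "(\<Sum>x\<in>S. w x * X x) = E1 + B1" unfolding E1_def B1_def by (rule split)
  have delta: "\<delta> + (\<Sum>x\<in>K. w x) = 1"
    using w split[of w] by (simp add: \<delta>_def prob_dist_def)
  have delta0: "0 \<le> \<delta>" unfolding \<delta>_def using w0 by (intro sum_nonneg) (auto simp: H_def)
  have K0: "0 \<le> (\<Sum>x\<in>K. w x)" using w0 by (intro sum_nonneg) (auto simp: K_def)
  have T00: "0 \<le> T0" unfolding T0_def using w0 by (intro sum_nonneg) (auto simp: K_def)
  have T0_le: "T0 \<le> 1 - \<delta>"
  proof -
    have "T0 \<le> (\<Sum>x\<in>K. w x)" unfolding T0_def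
    proof (rule sum_mono)
      fix x assume "x \<in> K"
      then have "x \<in> S" "X x \<le> 1" by (auto simp: K_def)
      then show "w x * X x powr s \<le> w x"
        using w0[of x] X(1)[of x] s by (intro mult_left_le powr_le1) auto
    qed
    then show ?thesis using delta by simp
  qed
  have B1_le: "B1 \<le> T0" unfolding B1_def T0_def
  proof (intro sum_mono)
    fix x assume "x \<in> K"
    then have x: "x \<in> S" "X x \<le> 1" by (auto simp: K_def)
    have "X x \<le> X x powr s"
    proof (cases "X x = 0")
      case False
      then show ?thesis
        using X(1)[OF x(1)] x(2) s powr_mono'[of s 1 "X x"] by simp
    qed simp
    then show "w x * X x \<le> w x * X x powr s"
      using w0[OF x(1)] by (rule mult_left_mono)
  qed
  have wH: "0 \<le> w x" "1 \<le> X x" "X x \<le> b" if "x \<in> H" for x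
    using that w0 X by (auto simp: H_def)
  \<comment> \<open>\<open>eta\<close> is affine in its second argument, so
    \<open>\<epsilon>\<close> enters only through \<open>\<epsilon> * T\<close>.\<close>
  have eta_T: "eta T (\<epsilon> + ln b) = \<epsilon> * T + eta T (ln b)" by (simp add: eta_def algebra_simps)
  have bs: "b powr s \<le> b" using b s powr_mono[of s 1 b] by simp
  have T1_lo: "\<delta> \<le> T1" unfolding T1_def \<delta>_def
    using wH s by (intro sum_mono) (simp add: mult_le_cancel_left1 ge_one_powr_ge_zero leD)
  have T1_hi: "T1 \<le> \<delta> * b powr s" unfolding T1_def \<delta>_def sum_distrib_right
    using wH s by (intro sum_mono mult_left_mono powr_mono2) force+
  have E1_lo: "\<delta> \<le> E1" unfolding E1_def \<delta>_def
    using wH by (intro sum_mono) (simp add: mult_le_cancel_left1 leD)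
  have E1_hi: "E1 \<le> \<delta> * b" unfolding E1_def \<delta>_def sum_distrib_right
    using wH by (intro sum_mono mult_left_mono) auto
  have chord: "(E1 - \<delta>) * (b powr s - 1) \<le> (T1 - \<delta>) * (b - 1)"
  proof -
    have "(\<Sum>x\<in>H. w x * ((X x - 1) * (b powr s - 1))) \<le> (\<Sum>x\<in>H. w x * ((X x powr s - 1) * (b - 1)))"
      using wH s by (intro sum_mono mult_left_mono powr_ge_chord) auto
    moreover have "(\<Sum>x\<in>H. w x * ((X x - 1) * (b powr s - 1))) = (E1 - \<delta>) * (b powr s - 1)"
      unfolding E1_def \<delta>_def sum_subtractf[symmetric] sum_distrib_right
      by (intro sum.cong) (auto simp: algebra_simps)
    moreover have "(\<Sum>x\<in>H. w x * ((X x powr s - 1) * (b - 1))) = (T1 - \<delta>) * (b - 1)"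
      unfolding T1_def \<delta>_def sum_subtractf[symmetric] sum_distrib_right
      by (intro sum.cong) (auto simp: algebra_simps)
    ultimately show ?thesis by simp
  qed
  have T_nonneg: "0 \<le> T" using T_eq T00 T1_lo delta0 by simp
  have "\<delta> * b powr s \<le> \<delta> * b" using bs delta0 by (rule mult_left_mono)
  moreover have "1 - \<delta> \<le> (1 - \<delta>) * b"
    using mult_left_mono[of 1 b "1 - \<delta>"] b delta K0 by simp
  ultimately have "T \<le> b"
    using T_eq T1_hi T0_le by (simp add: algebra_simps)
  with T_nonneg have etaT0: "0 \<le> eta T (ln b)" by (rule eta_nonneg)
  have main: "\<epsilon> * (E1 + B1) \<le> \<epsilon> * T + eta T (ln b) \<or>
      eta \<delta> (ln b) + \<epsilon> * B1 \<le> \<epsilon> * T + eta T (ln b)"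
  proof (cases "\<delta> = 0")
    case True
    have "\<epsilon> * B1 \<le> \<epsilon> * T"
      using B1_le T_eq T1_lo True eps by (intro mult_left_mono) auto
    then show ?thesis using True etaT0 by (simp add: eta_def)
  next
    case False
    then have d: "0 < \<delta>" using delta0 by simp
    have "b \<noteq> 1"
    proof
      assume "b = 1"
      then have "H = {}" using X(2) by (fastforce simp: H_def)
      then show False using False by (simp add: \<delta>_def)
    qed
    then have b1: "1 < b" using b by simp
    have E1_pos: "0 < E1" using E1_lo d by simp
    \<comment> \<open>Dividing by the mass \<open>\<delta>\<close> of \<open>H\<close> passes to
      conditional means.\<close>
    have "(E1 / \<delta> - T1 / \<delta>) * eta \<delta> (ln b) \<le> E1 / \<delta> * eta (\<delta> * (T1 / \<delta>) + T0) (ln b)"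
    proof (rule eta_mixture_ge[OF b1 s])
      show "(E1 / \<delta> - 1) * (b powr s - 1) \<le> (T1 / \<delta> - 1) * (b - 1)"
        using divide_right_mono[OF chord, of \<delta>] d by (simp add: field_simps)
    qed (use d delta K0 T1_lo T1_hi E1_lo E1_hi T00 T0_le in \<open>auto simp: field_simps\<close>)
    then have "(E1 - T1) * eta \<delta> (ln b) / \<delta> \<le> E1 * eta T (ln b) / \<delta>"
      using d by (simp add: T_eq diff_divide_distrib left_diff_distrib)
    then have "(E1 - T1) * eta \<delta> (ln b) \<le> E1 * eta T (ln b)"
      using d by (simp add: divide_le_cancel)
    moreover have etad: "0 \<le> eta \<delta> (ln b)" using d delta K0 b by (intro eta_nonneg) auto
    then have "(E1 + B1 - T) * eta \<delta> (ln b) \<le> (E1 - T1) * eta \<delta> (ln b)"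
      using B1_le T_eq by (intro mult_right_mono) auto
    ultimately have key: "(E1 + B1 - T) * eta \<delta> (ln b) \<le> E1 * eta T (ln b)" by linarith
    show ?thesis
    proof (rule ccontr)
      assume "\<not> ?thesis"
      then have 1: "eta T (ln b) < \<epsilon> * (E1 + B1 - T)"
        and 2: "eta T (ln b) + \<epsilon> * (T - B1) < eta \<delta> (ln b)"
        by (auto simp: algebra_simps)
      have pos: "0 < E1 + B1 - T"
        using 1 etaT0 eps by (smt (verit) zero_less_mult_pos)
      have TB: "0 \<le> T - B1" using B1_le T_eq T1_lo d by simp
      \<comment> \<open>Splitting \<open>E1\<close> into \<open>E1 + B1 - T\<close> and
        \<open>T - B1\<close> lets fact 1 bound the second part and fact 2 the total, which
        eliminates \<open>\<epsilon>\<close> and contradicts \<open>key\<close>.\<close>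
      have "E1 * eta T (ln b) = (E1 + B1 - T) * eta T (ln b) + eta T (ln b) * (T - B1)"
        by (simp add: algebra_simps)
      also have "\<dots> \<le> (E1 + B1 - T) * eta T (ln b) + \<epsilon> * (E1 + B1 - T) * (T - B1)"
        using 1 TB by (intro add_left_mono mult_right_mono) auto
      also have "\<dots> = (E1 + B1 - T) * (eta T (ln b) + \<epsilon> * (T - B1))"
        by (simp add: algebra_simps)
      also have "\<dots> < (E1 + B1 - T) * eta \<delta> (ln b)"
        using 2 pos by (rule mult_strict_left_mono)
      finally show False using key by simp
    qed
  qed
  then show ?thesis
    unfolding eta_T EX_eq by (simp add: \<delta>_def B1_def H_def K_def)
qed

section \<open>From entropies to moments of \<open>X\<close>\<close>

text \<open>A vanishing sum gives infinite entropy and hence the value 0, so one formula covers both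
  cases.\<close>

lemma exp_neg_H2:
  assumes "\<And>e. e \<in> E \<Longrightarrow> 0 \<le> Q e"
  shows "exp_neg (H2 A E P' Q) = (\<Sum>x\<in>A \<times> E. (P' x)\<^sup>2 * inverse (Q (snd x)))"
proof -
  have "0 \<le> (\<Sum>a\<in>A. \<Sum>e\<in>E. (P' (a, e))\<^sup>2 * inverse (Q e))"
    using assms by (intro sum_nonneg) auto
  then show ?thesis
    by (simp add: exp_neg_def H2_def Let_def sum.cartesian_product case_prod_beta')
qed

theorem theorem23:
  fixes A :: "'a set" and E :: "'e set"
    and P :: "'a \<times> 'e \<Rightarrow> real" and M :: nat and \<epsilon> s :: real
  assumes "finite A" and "finite E"
    and "prob_dist (A \<times> E) P"
    and "1 \<le> M" and "0 < \<epsilon>"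
    and "0 < s" and "s \<le> 1"
  shows "Delta_I2 A E M \<epsilon> P
           \<le> eta (real M powr s * exp (- s * H_down A E s P)) (\<epsilon> + ln (real M))"
proof -
  let ?Q = "marginal A P"
  \<comment> \<open>Where the marginal vanishes, division by zero gives \<open>X x = 0\<close>, and
    \<open>P x\<close> is 0 there as well.\<close>
  define X where "X x = real M * (P x / ?Q (snd x))" for x
  define T where "T = (\<Sum>x\<in>A \<times> E. P x * X x powr s)"
  have P0: "0 \<le> P x" if "x \<in> A \<times> E" for x using assms(3) that by (auto simp: prob_dist_def)
  have Q0: "0 \<le> ?Q e" if "e \<in> E" for e
    unfolding marginal_def using P0 that by (intro sum_nonneg) auto
  have PQ: "P x \<le> ?Q (snd x)" if "x \<in> A \<times> E" for x
    unfolding marginal_def using that assms(1) P0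
      member_le_sum[of "fst x" A "\<lambda>a. P (a, snd x)"] by (cases x) auto
  have X0: "0 \<le> X x" if "x \<in> A \<times> E" for x
    unfolding X_def using P0[OF that] Q0 that by auto
  have XM: "X x \<le> real M" if "x \<in> A \<times> E" for x
    unfolding X_def using PQ[OF that] P0[OF that]
    by (intro mult_left_le) (auto simp: divide_le_eq_1)
  have T_eq: "real M powr s * exp (- s * H_down A E s P) = T"
  proof -
    define Z where "Z = (\<Sum>a\<in>A. \<Sum>e\<in>{e\<in>E. 0 < ?Q e}. P (a, e) powr (1 + s) * ?Q e powr (- s))"
    have term_eq: "P x * (P x / ?Q (snd x)) powr s = P x powr (1 + s) * ?Q (snd x) powr (- s)"
      if "x \<in> A \<times> E" for x
    proof (cases "P x = 0")
      case False
      then have "0 < P x" "0 < ?Q (snd x)" using P0[OF that] PQ[OF that] by auto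
      then show ?thesis by (simp add: powr_add powr_divide powr_minus_divide)
    qed simp
    \<comment> \<open>Points of zero marginal may be added since
      \<open>0 powr (- s) = 0\<close>.\<close>
    have "Z = (\<Sum>a\<in>A. \<Sum>e\<in>E. P (a, e) powr (1 + s) * ?Q e powr (- s))"
      unfolding Z_def
      using assms(2) Q0 by (intro sum.cong[OF refl] sum.mono_neutral_left) force+
    also have "\<dots> = (\<Sum>x\<in>A \<times> E. P x * (P x / ?Q (snd x)) powr s)"
      using term_eq by (simp add: sum.cartesian_product case_prod_beta')
    finally have Z_eq: "Z = (\<Sum>x\<in>A \<times> E. P x * (P x / ?Q (snd x)) powr s)" .
    \<comment> \<open>Needed for \<open>exp\<close> to undo \<open>ln\<close>, as
      \<open>ln 0 = 0\<close>; if \<open>Z\<close> vanished, so would \<open>P\<close>.\<close>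
    have "Z \<noteq> 0"
    proof
      assume "Z = 0"
      then have "\<forall>x\<in>A \<times> E. P x * (P x / ?Q (snd x)) powr s = 0"
        unfolding Z_eq using assms P0 by (subst (asm) sum_nonneg_eq_0_iff) auto
      then have "P x = 0" if "x \<in> A \<times> E" for x
        using that PQ[OF that] P0[OF that] by force
      then show False using assms(3) by (simp add: prob_dist_def)
    qed
    moreover have "0 \<le> Z" unfolding Z_eq using P0 by (intro sum_nonneg) auto
    ultimately have "exp (- s * H_down A E s P) = Z"
      using assms by (simp add: H_down_def flip: Z_def)
    moreover have "real M powr s * Z = T"
      unfolding Z_eq T_def X_def sum_distrib_left
      using P0 Q0 by (intro sum.cong) (auto simp: powr_mult simp del: times_divide_eq_right)
    ultimately show ?thesis by simp
  qed
  have le: "Delta_I2 A E M \<epsilon> P \<le> Delta_objective A E M \<epsilon> P P'" if "P' \<in> feasible A E P" for P'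
    unfolding Delta_I2_def using assms that by (intro cINF_lower Delta_objective_bdd_below)
  have collision: "real M * exp_neg (H2 A E P ?Q) = (\<Sum>x\<in>A \<times> E. P x * X x)"
    using Q0 by (simp add: exp_neg_H2 sum_distrib_left X_def power2_eq_square field_simps)
  define P' where "P' x = (if X x \<le> 1 then P x else 0)" for x
  \<comment> \<open>Pointwise domination by \<open>P\<close> yields both the mass bound and the
    marginal constraint.\<close>
  have "0 \<le> P' x" "P' x \<le> P x" if "x \<in> A \<times> E" for x
    using P0[OF that] by (auto simp: P'_def)
  then have feas: "P' \<in> feasible A E P"
    using assms(3) sum_mono[of "A \<times> E" P' P]
    by (auto simp: feasible_def sub_dist_def prob_dist_def marginal_def intro!: sum_mono)
  have collision': "real M * exp_neg (H2 A E P' ?Q) = (\<Sum>x\<in>{x\<in>A \<times> E. X x \<le> 1}. P x * X x)"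
  proof -
    have "real M * exp_neg (H2 A E P' ?Q)
        = (\<Sum>x\<in>A \<times> E. if X x \<le> 1 then P x * X x else 0)"
      by (simp add: exp_neg_H2 Q0 sum_distrib_left, intro sum.cong) (auto simp: P'_def X_def power2_eq_square field_simps)
    also have "\<dots> = (\<Sum>x\<in>{x\<in>A \<times> E. X x \<le> 1}. P x * X x)"
      using assms by (intro sum.inter_filter[symmetric]) auto
    finally show ?thesis .
  qed
  have norm': "norm1 (A \<times> E) (\<lambda>x. P x - P' x) = (\<Sum>x\<in>{x\<in>A \<times> E. 1 < X x}. P x)"
  proof -
    have "norm1 (A \<times> E) (\<lambda>x. P x - P' x) = (\<Sum>x\<in>A \<times> E. if 1 < X x then P x else 0)"
      unfolding norm1_def using P0 by (intro sum.cong) (auto simp: P'_def)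
    also have "\<dots> = (\<Sum>x\<in>{x\<in>A \<times> E. 1 < X x}. P x)"
      using assms by (intro sum.inter_filter[symmetric]) auto
    finally show ?thesis .
  qed
  have "Delta_objective A E M \<epsilon> P P = \<epsilon> * (\<Sum>x\<in>A \<times> E. P x * X x)"
    by (simp add: Delta_objective_def norm1_def eta_def mult.assoc collision)
  moreover have "Delta_objective A E M \<epsilon> P P'
      = eta (\<Sum>x\<in>{x\<in>A \<times> E. 1 < X x}. P x) (ln (real M))
        + \<epsilon> * (\<Sum>x\<in>{x\<in>A \<times> E. X x \<le> 1}. P x * X x)"
    by (simp add: Delta_objective_def norm' mult.assoc collision')
  moreover have "\<epsilon> * (\<Sum>x\<in>A \<times> E. P x * X x) \<le> eta T (\<epsilon> + ln (real M)) \<or>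
      eta (\<Sum>x\<in>{x\<in>A \<times> E. 1 < X x}. P x) (ln (real M))
        + \<epsilon> * (\<Sum>x\<in>{x\<in>A \<times> E. X x \<le> 1}. P x * X x) \<le> eta T (\<epsilon> + ln (real M))"
    unfolding T_def using assms X0 XM by (intro truncation_tradeoff) auto
  ultimately show ?thesis
    using le[OF self_feasible[OF assms(3)]] le[OF feas] unfolding T_eq by linarith
qed

end
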